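(* Let $a_1,\dots,a_5,b_1,\dots,b_4>0$, $\gamma,\beta\in(0,1)$, $L>0$ and $0<\bar T\le 1$. The solutions $u_N^n,v_N^n,\theta_N^n$ ($1\le n\le\bar K$) of the fully discrete spectral scheme described in the context are stable and satisfy $$\|u_N^n\|^2+\|v_N^n\|^2+\|\theta_N^n\|^2\le C\tau\Big(\sum_{k=1}^n\|f^k\|^2+\sum_{k=1}^n\|g^k\|^2+\sum_{k=1}^n\|\widetilde p^{\,k}\|^2\Big),$$ where $C$ is a positive constant independent of the time step $\tau$ and of the polynomial degree $N$.
   Context: $\Omega=[0,L]$; $(\cdot,\cdot)$ and $\|\cdot\|$ are the $L^2(\Omega)$ inner product and norm; $\nabla=\partial_z$. $P_N(\Omega)$ is the space of polynomials of degree at most $N$ and $V_N^0=P_N(\Omega)\cap H_0^1(\Omega)$. Let $\bar K$ be a positive integer, $\tau=\bar T/\bar K$, $t_k=k\tau$. The source terms $f,g,\widetilde p$ are given functions of $(z,t)$ on $\Omega\times[0,\bar T]$, with $f^k=f(\cdot,t_k)$, $g^k=g(\cdot,t_k)$, $\widetilde p^{\,k}=\widetilde p(\cdot,t_k)$. First-order difference: $\partial_t w^1=\frac{w^1-w^0}{\tau}$ and $\partial_t w^k=\frac{3w^k-4w^{k-1}+w^{k-2}}{2\tau}$ for $k\ge2$. Fractional backward difference: for $-1\le s\le 1$, $D_\tau^{s}w^k=\tau^{-s}\sum_{l=0}^k\omega^{(s)}_{k-l}w^l$, where $\{\omega_k^{(s)}\}$ are the Taylor coefficients of $\left(\frac32-2x+\frac12x^2\right)^{s}=\sum_{k\ge0}\omega_k^{(s)}x^k$.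 Fully discrete spectral scheme: $u_N^0=v_N^0=\theta_N^0=0$, and for $k\ge1$ find $u_N^k,v_N^k,\theta_N^k\in V_N^0$ such that for all $\varphi_N\in V_N^0$ $$(\partial_tu_N^k,\varphi_N)+a_1(D_\tau^\gamma u_N^k,\varphi_N)+a_2(D_\tau^\gamma\nabla u_N^k,\nabla\varphi_N)+(\nabla u_N^k,\nabla\varphi_N)+a_3(u_N^k,\varphi_N)-a_4(v_N^k,\varphi_N)-a_5(\theta_N^k,\varphi_N)=(f^k,\varphi_N),$$ $$(\partial_tv_N^k,\varphi_N)+a_1(D_\tau^\gamma v_N^k,\varphi_N)+a_2(D_\tau^\gamma\nabla v_N^k,\nabla\varphi_N)+(\nabla v_N^k,\nabla\varphi_N)+a_3(v_N^k,\varphi_N)+a_4(u_N^k,\varphi_N)=(g^k,\varphi_N),$$ $$(\partial_t\theta_N^k,\varphi_N)+b_1(D_\tau^{1-\beta}\theta_N^k,\varphi_N)+b_2(D_\tau^{-\beta}\nabla\theta_N^k,\nabla\varphi_N)-b_3(D_\tau^{-\beta}\theta_N^k,\varphi_N)-b_4(\theta_N^k,\varphi_N)=(\widetilde p^{\,k},\varphi_N).$$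
   Formalization: The estimate is proved for τ ≤ τ₀, with τ₀ > 0 depending only on the a_i, b_i, γ, β, L, T̄. For arbitrary τ it is false: with T̄ = K̄ = 1, N = 2, a suitable b_4 > 0 makes the θ-equation singular, so nonzero θ_N^1 occurs for zero data. *)

theory Defs
  imports "HOL-Analysis.Analysis" "HOL-Computational_Algebra.Polynomial"
begin

definition L2 :: "real \<Rightarrow> (real \<Rightarrow> real) set" where
  "L2 L = {w. w \<in> borel_measurable (lebesgue_on {0..L}) \<and>
              integrable (lebesgue_on {0..L}) (\<lambda>z. (w z)\<^sup>2)}"

definition ip :: "real \<Rightarrow> (real \<Rightarrow> real) \<Rightarrow> (real \<Rightarrow> real) \<Rightarrow> real" where
  "ip L v w = (LINT z|lebesgue_on {0..L}. v z * w z)"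

definition nrm :: "real \<Rightarrow> (real \<Rightarrow> real) \<Rightarrow> real" where
  "nrm L w = sqrt (ip L w w)"

definition test_functions :: "real \<Rightarrow> (real \<Rightarrow> real) set" where
  "test_functions L = {\<phi>. (\<forall>n x. (deriv ^^ n) \<phi> field_differentiable at x) \<and>
                          closure {x. \<phi> x \<noteq> 0} \<subseteq> {0<..<L}}"

text \<open>The closure of the test functions in the norm of \<open>H\<^sup>1\<close>. The limit \<open>dw\<close> of the
  derivatives is the weak derivative of \<open>w\<close>. Elements are functions, not classes modulo
  null sets, and their values outside \<open>{0..L}\<close> are irrelevant.\<close>

definition H1_0 :: "real \<Rightarrow> (real \<Rightarrow> real) set" where
  "H1_0 L = {w \<in> L2 L. \<exists>dw \<in> L2 L. \<exists>\<phi>. (\<forall>j::nat. \<phi> j \<in> test_functions L) \<and>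
      (\<lambda>j. nrm L (\<lambda>z. \<phi> j z - w z)) \<longlonglongrightarrow> 0 \<and>
      (\<lambda>j. nrm L (\<lambda>z. deriv (\<phi> j) z - dw z)) \<longlonglongrightarrow> 0}"

definition P_space :: "nat \<Rightarrow> (real \<Rightarrow> real) set" where
  "P_space N = {poly q | q. degree q \<le> N}"

definition V0 :: "real \<Rightarrow> nat \<Rightarrow> (real \<Rightarrow> real) set" where
  "V0 L N = P_space N \<inter> H1_0 L"

text \<open>Only used for \<open>k \<ge> 1\<close>.\<close>

definition dtau :: "real \<Rightarrow> (nat \<Rightarrow> real \<Rightarrow> real) \<Rightarrow> nat \<Rightarrow> real \<Rightarrow> real" where
  "dtau \<tau> w k z = (if k = 1 then (w 1 z - w 0 z) / \<tau>
                   else (3 * w k z - 4 * w (k - 1) z + w (k - 2) z) / (2 * \<tau>))"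

definition weight :: "real \<Rightarrow> nat \<Rightarrow> real" where
  "weight s k = (deriv ^^ k) (\<lambda>x. (3/2 - 2 * x + 1/2 * x\<^sup>2) powr s) 0 / fact k"

definition Dfrac :: "real \<Rightarrow> real \<Rightarrow> (nat \<Rightarrow> real \<Rightarrow> real) \<Rightarrow> nat \<Rightarrow> real \<Rightarrow> real" where
  "Dfrac \<tau> s w k z = \<tau> powr (- s) * (\<Sum>l=0..k. weight s (k - l) * w l z)"

abbreviation grad :: "(nat \<Rightarrow> real \<Rightarrow> real) \<Rightarrow> nat \<Rightarrow> real \<Rightarrow> real" where
  "grad w \<equiv> (\<lambda>k. deriv (w k))"

text \<open>The value at time level \<open>k\<close> of a function of \<open>(z, t)\<close>.\<close>

definition at_level :: "real \<Rightarrow> (real \<Rightarrow> real \<Rightarrow> real) \<Rightarrow> nat \<Rightarrow> real \<Rightarrow> real" where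
  "at_level \<tau> f k z = f z (real k * \<tau>)"

definition spectral_scheme ::
  "real \<Rightarrow> real \<Rightarrow> real \<Rightarrow> real \<Rightarrow> real \<Rightarrow> real \<Rightarrow> real \<Rightarrow> real \<Rightarrow> real \<Rightarrow> real \<Rightarrow> real \<Rightarrow>
   real \<Rightarrow> real \<Rightarrow> nat \<Rightarrow> nat \<Rightarrow>
   (real \<Rightarrow> real \<Rightarrow> real) \<Rightarrow> (real \<Rightarrow> real \<Rightarrow> real) \<Rightarrow> (real \<Rightarrow> real \<Rightarrow> real) \<Rightarrow>
   (nat \<Rightarrow> real \<Rightarrow> real) \<Rightarrow> (nat \<Rightarrow> real \<Rightarrow> real) \<Rightarrow> (nat \<Rightarrow> real \<Rightarrow> real) \<Rightarrow> bool" where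
  "spectral_scheme a1 a2 a3 a4 a5 b1 b2 b3 b4 \<gamma> \<beta> L \<tau> K N f g p u v \<theta> \<longleftrightarrow>
     u 0 = (\<lambda>z. 0) \<and> v 0 = (\<lambda>z. 0) \<and> \<theta> 0 = (\<lambda>z. 0) \<and>
     (\<forall>k\<in>{1..K}. u k \<in> V0 L N \<and> v k \<in> V0 L N \<and> \<theta> k \<in> V0 L N \<and>
       (\<forall>\<phi>\<in>V0 L N.
          ip L (dtau \<tau> u k) \<phi> + a1 * ip L (Dfrac \<tau> \<gamma> u k) \<phi>
            + a2 * ip L (Dfrac \<tau> \<gamma> (grad u) k) (deriv \<phi>)
            + ip L (deriv (u k)) (deriv \<phi>) + a3 * ip L (u k) \<phi>
            - a4 * ip L (v k) \<phi> - a5 * ip L (\<theta> k) \<phi>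
          = ip L (at_level \<tau> f k) \<phi> \<and>
          ip L (dtau \<tau> v k) \<phi> + a1 * ip L (Dfrac \<tau> \<gamma> v k) \<phi>
            + a2 * ip L (Dfrac \<tau> \<gamma> (grad v) k) (deriv \<phi>)
            + ip L (deriv (v k)) (deriv \<phi>) + a3 * ip L (v k) \<phi>
            + a4 * ip L (u k) \<phi>
          = ip L (at_level \<tau> g k) \<phi> \<and>
          ip L (dtau \<tau> \<theta> k) \<phi> + b1 * ip L (Dfrac \<tau> (1 - \<beta>) \<theta> k) \<phi>
            + b2 * ip L (Dfrac \<tau> (- \<beta>) (grad \<theta>) k) (deriv \<phi>)
            - b3 * ip L (Dfrac \<tau> (- \<beta>) \<theta> k) \<phi> - b4 * ip L (\<theta> k) \<phi>
          = ip L (at_level \<tau> p k) \<phi>))"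

text \<open>The estimate is claimed for \<open>\<tau> \<le> \<tau>\<^sub>0\<close>, where \<open>\<tau>\<^sub>0\<close>, like the constant \<open>C\<close>, depends
  only on the coefficients and on \<open>\<gamma>\<close>, \<open>\<beta>\<close>, \<open>L\<close>, \<open>T\<close>. It is false for arbitrary \<open>\<tau>\<close>: the terms
  with \<open>b3\<close> and \<open>b4\<close> have the wrong sign. For \<open>T = K = 1\<close> and \<open>N = 2\<close> (so that \<open>V0 L N\<close> is
  spanned by \<open>z * (L - z)\<close> and \<open>\<tau> = 1\<close>), choosing
  \<open>b4 = 1 + b1 * (3/2) powr (1 - \<beta>) + (10 * b2 / L\<^sup>2 - b3) * (3/2) powr (- \<beta>)\<close>
  (positive for small \<open>b3\<close>) makes the equation for \<open>\<theta> 1\<close> singular, so that the scheme has nonzero solutions for zero data.\<close>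

end

theory Submission
  imports Defs
begin

text \<open>
  Test each equation with its own solution at level \<open>k\<close> and sum over \<open>k \<le> n\<close>. The BDF2 difference
  telescopes to at least \<open>\<parallel>w n\<parallel>\<^sup>2 / 4 - \<parallel>w 1\<parallel>\<^sup>2 / 4\<close>, and the case \<open>n = 1\<close> (implicit Euler) controls the loss.
  The symbol \<open>\<delta>(z) = (1 - z) (3 - z) / 2\<close> maps the unit disc into the right half plane, hence so does
  \<open>\<delta> powr s\<close> for \<open>\<bar>s\<bar> \<le> 1\<close>, and all fractional sums with a good sign are nonnegative. The sum with
  \<open>b3\<close> is bounded by \<open>6 \<Sum> \<parallel>\<theta> k\<parallel>\<^sup>2\<close>, because the weights of order \<open>-\<beta>\<close> are nonnegative and their first
  \<open>n\<close> terms add up to \<open>O(n powr \<beta>)\<close>; the \<open>a4\<close> terms cancel. For small \<open>\<tau>\<close> the discrete Gronwall inequality applies.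
\<close>

subsection \<open>The weights and their generating function\<close>

text \<open>The factorisation \<open>3/2 - 2*x + x^2/2 = 3/2 * (1 - x) * (1 - x/3)\<close> makes
  these numbers the Cauchy product of the binomial series of \<open>(1 - x) powr s\<close> and
  \<open>(1 - x/3) powr s\<close>.\<close>

definition bdf2_coeff :: "real \<Rightarrow> nat \<Rightarrow> real" where
  "bdf2_coeff s k = (3/2) powr s * (\<Sum>i\<le>k. ((s gchoose i) * (-1)^i) * ((s gchoose (k-i)) * (-1/3)^(k-i)))"

lemma of_real_gchoose: "of_real (a gchoose n) = (of_real a gchoose n :: 'a :: {real_normed_field})"
  by (simp add: gbinomial_prod_rev)

text \<open>Both binomial series converge absolutely in the unit disc, so their Cauchy product
  converges to the product of the sums. The two principal powers stay separate here, which avoids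
  any question of branches.\<close>

lemma bdf2_symbol_sums:
  fixes z :: complex
  assumes "norm z < 1"
  shows "(\<lambda>k. of_real (bdf2_coeff s k) * z ^ k) sums
           (of_real ((3/2) powr s) * ((1 - z) powr of_real s * (1 - z/3) powr of_real s))"
proof -
  define A where "A = (\<lambda>i. (complex_of_real s gchoose i) * (-z)^i)"
  define B where "B = (\<lambda>i. (complex_of_real s gchoose i) * (-z/3)^i)"
  have n: "norm (-z) < 1" "norm (-z/3) < 1"
    using assms by (auto simp: norm_divide)
  have R: "1 \<le> conv_radius (\<lambda>n. complex_of_real s gchoose n)"
    by (simp add: conv_radius_gchoose)
  have A: "summable (\<lambda>i. norm (A i))" and B: "summable (\<lambda>i. norm (B i))"
    unfolding A_def B_def
    by (rule abs_summable_in_conv_radius, rule less_le_trans[OF _ R], use n in simp)+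
  have sA: "suminf A = (1 - z) powr s" and sB: "suminf B = (1 - z/3) powr s"
    using gen_binomial_complex[OF n(1), of s] gen_binomial_complex[OF n(2), of s]
    by (auto simp: A_def B_def sums_iff)
  have "(\<Sum>i\<le>k. A i * B (k - i)) * of_real ((3/2) powr s) = of_real (bdf2_coeff s k) * z ^ k" for k
  proof -
    have "A i * B (k - i) = of_real (((s gchoose i) * (-1)^i) * ((s gchoose (k-i)) * (-1/3)^(k-i))) * z ^ k"
      if "i \<le> k" for i
    proof -
      have zk: "z ^ k = z ^ i * z ^ (k - i)" using that by (simp flip: power_add)
      have "(-z)^i = (-1)^i * z^i" "(-z/3)^(k-i) = (-1/3)^(k-i) * z^(k-i)"
        by (simp_all flip: power_mult_distrib)
      then show ?thesis
        unfolding A_def B_def zk by (simp add: of_real_gchoose)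
    qed
    then have "(\<Sum>i\<le>k. A i * B (k - i)) = 
      of_real (\<Sum>i\<le>k. ((s gchoose i) * (-1)^i) * ((s gchoose (k-i)) * (-1/3)^(k-i))) * z ^ k"
      by (simp only: of_real_sum sum_distrib_right) (auto intro!: sum.cong)
    then show ?thesis unfolding bdf2_coeff_def by (simp del: of_real_sum)
  qed
  with sums_mult2[OF Cauchy_product_sums[OF A B], of "of_real ((3/2) powr s)"]
  show ?thesis by (simp add: sA sB mult_ac)
qed

text \<open>On the real interval both factors are positive, so the complex powers are real and merge
  into one power of the quadratic.\<close>

lemma bdf2_symbol_sums_real:
  fixes x :: real
  assumes "\<bar>x\<bar> < 1"
  shows "(\<lambda>k. bdf2_coeff s k * x ^ k) sums ((3/2 - 2 * x + 1/2 * x\<^sup>2) powr s)"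
proof -
  have pos: "0 < 1 - x" "0 < 1 - x / 3" using assms by auto
  have "(3/2 - 2 * x + 1/2 * x\<^sup>2) = 3/2 * ((1 - x) * (1 - x / 3))"
    by (simp add: field_simps power2_eq_square)
  then have e: "(3/2 - 2 * x + 1/2 * x\<^sup>2) powr s = (3/2) powr s * ((1 - x) powr s * (1 - x/3) powr s)"
    using pos by (simp add: powr_mult del: times_divide_eq_left times_divide_eq_right)
  have c: "complex_of_real (1 - x) powr of_real s = of_real ((1 - x) powr s)"
     "complex_of_real (1 - x/3) powr of_real s = of_real ((1 - x/3) powr s)"
    using pos by (intro powr_of_real; simp)+
  have "(\<lambda>k. complex_of_real (bdf2_coeff s k * x ^ k)) sums
     of_real ((3/2) powr s * ((1 - x) powr s * (1 - x/3) powr s))"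
    using bdf2_symbol_sums[of "of_real x" s] assms c by simp
  then show ?thesis unfolding e by (simp only: sums_of_real_iff)
qed

text \<open>Links the iterated \<open>deriv\<close> in \<open>weight\<close> to formal derivatives.
  The identity is carried along on the whole open interval, since agreement at a single point would
  not survive the next differentiation.\<close>

lemma higher_deriv_eq_eval_fps:
  fixes f :: "real \<Rightarrow> real"
  assumes "\<And>x. \<bar>x\<bar> < r \<Longrightarrow> f x = eval_fps F x" and "ereal r \<le> fps_conv_radius F" and "\<bar>x\<bar> < r"
  shows "(deriv ^^ n) f x = eval_fps ((fps_deriv ^^ n) F) x"
  using assms(3)
proof (induction n arbitrary: x)
  case 0
  then show ?case using assms(1) by simp
next
  case (Suc n)
  have "ereal r \<le> fps_conv_radius ((fps_deriv ^^ n) F)"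
    by (induction n) (use assms(2) fps_conv_radius_deriv order_trans in auto)
  then have "norm x < fps_conv_radius ((fps_deriv ^^ n) F)"
    using Suc.prems by (metis less_ereal.simps(1) order_less_le_trans real_norm_def)
  then have "(eval_fps ((fps_deriv ^^ n) F) has_field_derivative
      eval_fps ((fps_deriv ^^ Suc n) F) x) (at x)"
    by (auto intro!: has_field_derivative_eval_fps)
  then have "((deriv ^^ n) f has_field_derivative eval_fps ((fps_deriv ^^ Suc n) F) x) (at x)"
    by (rule has_field_derivative_transform_within_open[where S = "{-r<..<r}"])
      (use Suc in auto)
  then show ?case by (simp add: DERIV_imp_deriv)
qed

lemma weight_eq_bdf2_coeff: "weight s k = bdf2_coeff s k"
proof -
  define F where "F = Abs_fps (bdf2_coeff s)"
  have r: "fps_conv_radius F \<ge> ereal 1"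
    unfolding fps_conv_radius_def
  proof (rule conv_radius_geI_ex')
    fix r :: real assume "0 < r" "ereal r < ereal 1"
    then show "summable (\<lambda>n. fps_nth F n * of_real r ^ n)"
      using bdf2_symbol_sums_real[of r s] by (auto simp: F_def sums_iff)
  qed
  have "(deriv ^^ k) (\<lambda>x. (3/2 - 2 * x + 1/2 * x\<^sup>2) powr s) 0 = eval_fps ((fps_deriv ^^ k) F) 0"
    by (rule higher_deriv_eq_eval_fps[OF _ r])
      (use bdf2_symbol_sums_real[of _ s] in \<open>auto simp: F_def eval_fps_def sums_iff\<close>)
  then show ?thesis by (simp add: weight_def F_def eval_fps_at_0 fps_0th_higher_deriv)
qed

subsection \<open>Positivity of the fractional quadratic form\<close>

text \<open>This is the A-stability of BDF2. With \<open>w = (1 - z) * (1 - z/3)\<close>, three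
  times \<open>Re w\<close> equals \<open>2 * (1 - Re z)^2 + 1 - |z|^2\<close>, which is positive in
  the disc. The argument of \<open>w\<close> is thus below \<open>pi/2\<close> in modulus, and an
  exponent with \<open>\<bar>s\<bar> \<le> 1\<close> does not enlarge it.\<close>

lemma Re_bdf2_symbol_nonneg:
  fixes z :: complex
  assumes "norm z < 1" "\<bar>s\<bar> \<le> 1"
  shows "Re ((1 - z) powr of_real s * (1 - z/3) powr of_real s) \<ge> 0"
proof -
  define w where "w = (1 - z) * (1 - z/3)"
  have "Re z < 1" "\<bar>Re z\<bar> < 1" using assms(1) abs_Re_le_cmod[of z] by linarith+
  then have re: "0 < Re (1 - z)" "0 < Re (1 - z/3)" by auto
  have nz: "1 - z \<noteq> 0" "1 - z/3 \<noteq> 0" using re by (metis less_irrefl zero_complex.sel(1))+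
  have "(Re z)\<^sup>2 + (Im z)\<^sup>2 < 1"
    using assms(1) unfolding cmod_power2[symmetric] by (simp add: power_less_one_iff)
  moreover have "Re w = ((1 - Re z)\<^sup>2 * 2 + 1 - ((Re z)\<^sup>2 + (Im z)\<^sup>2)) / 3"
    unfolding w_def by (simp add: power2_eq_square field_simps)
  ultimately have "Re w > 0" by (smt (verit) divide_pos_pos zero_le_power2)
  moreover have "w \<noteq> 0" using nz by (simp add: w_def)
  ultimately have Im_w: "\<bar>Im (Ln w)\<bar> < pi/2" using Re_Ln_pos_lt by blast
  have "\<bar>Im (Ln (1 - z))\<bar> < pi/2" "\<bar>Im (Ln (1 - z/3))\<bar> < pi/2"
    using Re_Ln_pos_lt nz re by blast+
  \<comment> \<open>Each factor has argument below \<open>pi/2\<close> in modulus, so the sum stays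
    inside the principal strip and the logarithms add without a correction.\<close>
  then have Ln_w: "Ln w = Ln (1 - z) + Ln (1 - z/3)"
    unfolding w_def by (intro Ln_times_simple) (use nz in auto)
  have "(1 - z) powr of_real s * (1 - z/3) powr of_real s = exp (of_real s * Ln w)"
    using nz by (simp add: powr_def Ln_w exp_add ring_distribs)
  moreover have "\<bar>s * Im (Ln w)\<bar> \<le> 1 * (pi/2)"
    unfolding abs_mult by (intro mult_mono) (use assms Im_w in auto)
  ultimately show ?thesis by (auto simp: Re_exp intro!: mult_nonneg_nonneg cos_ge_zero)
qed

text \<open>The orthogonality relation that extracts single coefficients from the circle mean
  below.\<close>

lemma integral_cos_int:
  fixes j :: int
  shows "((\<lambda>t. cos (of_int j * t)) has_integral (if j = 0 then 2*pi else 0)) {0..2*pi}"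
proof (cases "j = 0")
  case True
  then show ?thesis using has_integral_const_real[of "1::real" 0 "2*pi"] by simp
next
  case False
  have "((\<lambda>t. cos (of_int j * t)) has_integral
      (sin (of_int j * (2*pi)) / of_int j - sin (of_int j * 0) / of_int j)) {0..2*pi}"
    by (rule fundamental_theorem_of_calculus)
      (use False in \<open>auto intro!: derivative_eq_intros simp flip: has_real_derivative_iff_has_vector_derivative\<close>)
  moreover have "sin (of_int j * (2*pi)) = 0"
    using sin_int_2pin[of j] by (simp add: mult_ac)
  ultimately show ?thesis using False by simp
qed

text \<open>The form is the mean over the circle of radius \<open>r\<close> of \<open>Re F\<close> times the squared modulus of the
  trigonometric polynomial with coefficients \<open>x\<close>. Truncating the series of \<open>F\<close> keeps all integrals elementary.\<close>

lemma toeplitz_form_nonneg_disc: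
  fixes c x :: "nat \<Rightarrow> real"
  assumes sums: "\<And>z. norm z < 1 \<Longrightarrow> (\<lambda>k. of_real (c k) * z ^ k) sums F z"
    and Re_F: "\<And>z. norm z < 1 \<Longrightarrow> Re (F z) \<ge> 0"
    and r: "0 < r" "r < 1"
  shows "0 \<le> (\<Sum>k\<le>n. \<Sum>l\<le>k. c (k - l) * r ^ (k - l) * x k * x l)"
proof -
  define Q where "Q = (\<Sum>k\<le>n. \<Sum>l\<le>k. c (k - l) * r ^ (k - l) * x k * x l)"
  define W where "W t = (\<Sum>l\<le>n. of_real (x l) * cis (of_nat l * t))" for t
  define P where "P m t = (\<Sum>i<m. of_real (c i) * (of_real r * cis t) ^ i)" for m t
  \<comment> \<open>The frequency of a term in \<open>P\<close> times the squared modulus of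
    \<open>W\<close>. It vanishes exactly when \<open>l \<le> k\<close> and
    \<open>i = k - l\<close>.\<close>
  define J where "J i k l = int i + int l - int k" for i k l :: nat
  define S where "S m = (\<Sum>i<m. \<bar>c i\<bar> * r ^ i)" for m
  define B where "B = integral {0..2*pi} (\<lambda>t. (cmod (W t))\<^sup>2)"
  have sqW: "of_real ((cmod (W t))\<^sup>2) = (\<Sum>k\<le>n. \<Sum>l\<le>n. of_real (x k * x l) * cis ((of_nat l - of_nat k) * t))" for t
  proof -
    have "of_real ((cmod (W t))\<^sup>2) = cnj (W t) * W t"
      by (metis complex_norm_square mult.commute of_real_power)
    also have "\<dots> = (\<Sum>k\<le>n. \<Sum>l\<le>n. (of_real (x k) * cis (- (of_nat k * t))) * (of_real (x l) * cis (of_nat l * t)))"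
      unfolding W_def by (simp add: sum_product cis_cnj)
    finally show ?thesis by (simp add: mult_ac cis_mult ring_distribs)
  qed
  have Re_PW: "Re (P m t) * (cmod (W t))\<^sup>2 =
      (\<Sum>i<m. \<Sum>k\<le>n. \<Sum>l\<le>n. c i * r ^ i * x k * x l * cos (of_int (J i k l) * t))" for m t
  proof -
    have "Re (P m t) * (cmod (W t))\<^sup>2 = Re (P m t * of_real ((cmod (W t))\<^sup>2))" by simp
    also have "P m t * of_real ((cmod (W t))\<^sup>2) = (\<Sum>i<m. \<Sum>k\<le>n. \<Sum>l\<le>n.
        (of_real (c i) * (of_real r * cis t) ^ i) * (of_real (x k * x l) * cis ((of_nat l - of_nat k) * t)))"
      by (simp only: sqW P_def sum_distrib_right) (simp only: sum_distrib_left)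
    also have "\<dots> = (\<Sum>i<m. \<Sum>k\<le>n. \<Sum>l\<le>n. of_real (c i * r ^ i * x k * x l) * cis (of_int (J i k l) * t))"
    proof (intro sum.cong refl)
      fix i k l
      have "cis t ^ i * cis ((of_nat l - of_nat k) * t) = cis (of_int (J i k l) * t)"
        unfolding Complex.DeMoivre cis_mult J_def by (simp add: algebra_simps)
      then show "(of_real (c i) * (of_real r * cis t) ^ i) * (of_real (x k * x l) * cis ((of_nat l - of_nat k) * t))
        = of_real (c i * r ^ i * x k * x l) * cis (of_int (J i k l) * t)"
        by (simp add: power_mult_distrib mult_ac)
    qed
    finally show ?thesis by simp
  qed
  have W_cont: "continuous_on {0..2*pi} (\<lambda>t. (cmod (W t))\<^sup>2)"
    unfolding W_def by (intro continuous_intros)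
  \<comment> \<open>The truncated symbol can be negative, but it differs from \<open>F\<close> by at
    most the tail of the absolute series, so its real part is at least minus that tail. The
    condition \<open>m > n\<close> ensures that every index \<open>k - l\<close> occurs in the
    truncation, hence the integral is exactly \<open>2 * pi * Q\<close>.\<close>
  have bound: "- ((suminf (\<lambda>i. \<bar>c i\<bar> * r ^ i) - S m)) * B \<le> 2 * pi * Q" if m: "m > n" for m
  proof -
    have "((\<lambda>t. Re (P m t) * (cmod (W t))\<^sup>2) has_integral
        (\<Sum>i<m. \<Sum>k\<le>n. \<Sum>l\<le>n. c i * r ^ i * x k * x l * (if J i k l = 0 then 2*pi else 0))) {0..2*pi}"
      unfolding Re_PW by (intro has_integral_sum has_integral_mult_right integral_cos_int) auto
    also have "(\<Sum>i<m. \<Sum>k\<le>n. \<Sum>l\<le>n. c i * r ^ i * x k * x l * (if J i k l = 0 then 2*pi else 0))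
        = (\<Sum>k\<le>n. \<Sum>l\<le>n. \<Sum>i<m. c i * r ^ i * x k * x l * (if J i k l = 0 then 2*pi else 0))"
      by (simp only: sum.swap[where A = "{..<m}" and B = "{..n}"])
    also have "\<dots> = (\<Sum>k\<le>n. \<Sum>l\<le>n. if l \<le> k then 2 * pi * (c (k - l) * r ^ (k - l) * x k * x l) else 0)"
    proof (intro sum.cong refl)
      fix k l assume "k \<in> {..n}" "l \<in> {..n}"
      have "(\<Sum>i<m. c i * r ^ i * x k * x l * (if J i k l = 0 then 2*pi else 0))
        = (\<Sum>i<m. if i = k - l then (if l \<le> k then 2 * pi * (c (k - l) * r ^ (k - l) * x k * x l) else 0) else 0)"
        by (intro sum.cong refl) (auto simp: J_def)
      also have "\<dots> = (if l \<le> k then 2 * pi * (c (k - l) * r ^ (k - l) * x k * x l) else 0)"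
        using m \<open>k \<in> {..n}\<close> by (subst sum.delta) auto
      finally show "(\<Sum>i<m. c i * r ^ i * x k * x l * (if J i k l = 0 then 2*pi else 0)) = \<dots>" .
    qed
    also have "\<dots> = (\<Sum>k\<le>n. \<Sum>l\<le>k. 2 * pi * (c (k - l) * r ^ (k - l) * x k * x l))"
    proof (rule sum.cong[OF refl])
      fix k assume "k \<in> {..n}"
      then show "(\<Sum>l\<le>n. if l \<le> k then 2 * pi * (c (k - l) * r ^ (k - l) * x k * x l) else 0)
          = (\<Sum>l\<le>k. 2 * pi * (c (k - l) * r ^ (k - l) * x k * x l))"
        by (intro sum.mono_neutral_cong_right) auto
    qed
    also have "\<dots> = 2 * pi * Q"
      unfolding Q_def by (simp add: sum_distrib_left)
    finally have I: "((\<lambda>t. Re (P m t) * (cmod (W t))\<^sup>2) has_integral 2 * pi * Q) {0..2*pi}" .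
    have "- ((suminf (\<lambda>i. \<bar>c i\<bar> * r ^ i) - S m)) \<le> Re (P m t)" for t
    proof -
      define z where "z = of_real r * cis t"
      have z: "norm z < 1" using r by (simp add: z_def norm_mult)
      have sm: "summable (\<lambda>i. norm (of_real (c i) * z ^ i))"
      proof -
        \<comment> \<open>Convergence at the larger radius \<open>(1 + r)/2 < 1\<close> yields
          absolute convergence on the circle of radius \<open>r\<close>.\<close>
        have "summable (\<lambda>i. complex_of_real (c i) * of_real ((1 + r)/2) ^ i)"
          using sums[of "of_real ((1 + r)/2)"] r by (simp add: sums_iff del: of_real_add of_real_divide)
        then show ?thesis
          by (rule powser_insidea) (use r in \<open>simp add: z_def norm_mult del: of_real_add of_real_divide\<close>)
      qed
      have nz: "norm (of_real (c i) * z ^ i) = \<bar>c i\<bar> * r ^ i" for i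
        using r by (simp add: z_def norm_mult norm_power)
      have "norm (F z - P m t) = norm (\<Sum>i. of_real (c (i + m)) * z ^ (i + m))"
      proof -
        have "F z = (\<Sum>i. of_real (c i) * z ^ i)" using sums[OF z] by (simp add: sums_iff)
        also have "\<dots> = (\<Sum>i. of_real (c (i + m)) * z ^ (i + m)) + P m t"
          unfolding P_def z_def[symmetric]
          by (rule suminf_split_initial_segment) (rule summable_norm_cancel[OF sm])
        finally show ?thesis by simp
      qed
      also have "\<dots> \<le> (\<Sum>i. norm (of_real (c (i + m)) * z ^ (i + m)))"
        by (rule summable_norm) (rule summable_ignore_initial_segment[OF sm])
      also have "\<dots> = suminf (\<lambda>i. \<bar>c i\<bar> * r ^ i) - S m"
        using suminf_minus_initial_segment[OF sm, of m] unfolding nz S_def .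
      finally have "norm (F z - P m t) \<le> \<dots>" .
      moreover have "Re (F z - P m t) \<le> norm (F z - P m t)" by (rule complex_Re_le_cmod)
      ultimately show ?thesis using Re_F[OF z] by simp
    qed
    then have "- ((suminf (\<lambda>i. \<bar>c i\<bar> * r ^ i) - S m)) * (cmod (W t))\<^sup>2 \<le> Re (P m t) * (cmod (W t))\<^sup>2" for t
      by (intro mult_right_mono) auto
    then show ?thesis
      unfolding B_def
      by (intro has_integral_le[OF has_integral_mult_right[OF integrable_integral] I])
        (auto intro: integrable_continuous_interval W_cont)
  qed
  have "S \<longlonglongrightarrow> suminf (\<lambda>i. \<bar>c i\<bar> * r ^ i)"
  proof -
    have "summable (\<lambda>i. complex_of_real (c i) * of_real ((1 + r)/2) ^ i)"
      using sums[of "of_real ((1 + r)/2)"] r by (simp add: sums_iff del: of_real_add of_real_divide)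
    then have "summable (\<lambda>i. norm (complex_of_real (c i) * of_real r ^ i))"
      by (rule powser_insidea) (use r in \<open>simp del: of_real_add of_real_divide\<close>)
    then show ?thesis
      unfolding S_def using r by (simp add: norm_mult norm_power summable_LIMSEQ)
  qed
  \<comment> \<open>\<open>Q\<close> does not depend on \<open>m\<close>, so letting the tail tend
    to zero leaves a nonnegative lower bound.\<close>
  then have "(\<lambda>m. - ((suminf (\<lambda>i. \<bar>c i\<bar> * r ^ i) - S m)) * B) \<longlonglongrightarrow>
      - (suminf (\<lambda>i. \<bar>c i\<bar> * r ^ i) - suminf (\<lambda>i. \<bar>c i\<bar> * r ^ i)) * B"
    by (intro tendsto_intros)
  then have "0 \<le> 2 * pi * Q"
    by (intro LIMSEQ_le_const2[where X = "\<lambda>m. - ((suminf (\<lambda>i. \<bar>c i\<bar> * r ^ i) - S m)) * B"])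
      (use bound in \<open>auto intro!: exI[of _ "Suc n"]\<close>)
  then show ?thesis unfolding Q_def[symmetric] zero_le_mult_iff using pi_gt_zero by linarith
qed

text \<open>For fixed \<open>n\<close> the damped form is a polynomial in \<open>r\<close>, so its
  sign passes to the limit \<open>r = 1\<close>, even if the series of \<open>F\<close> diverges on
  the unit circle.\<close>

lemma toeplitz_form_nonneg:
  fixes c x :: "nat \<Rightarrow> real"
  assumes sums: "\<And>z. norm z < 1 \<Longrightarrow> (\<lambda>k. of_real (c k) * z ^ k) sums F z"
    and Re_F: "\<And>z. norm z < 1 \<Longrightarrow> Re (F z) \<ge> 0"
  shows "0 \<le> (\<Sum>k\<le>n. (\<Sum>l\<le>k. c (k - l) * x l) * x k)"
proof -
  define Q where "Q r = (\<Sum>k\<le>n. \<Sum>l\<le>k. c (k - l) * r ^ (k - l) * x k * x l)" for r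
  have "(Q \<longlongrightarrow> Q 1) (at_left 1)"
    unfolding Q_def by (intro tendsto_intros)
  moreover have "\<forall>\<^sub>F r in at_left 1. 0 \<le> Q r"
    using eventually_at_left_real[of 0 1]
    by (auto elim!: eventually_mono simp: Q_def intro!: toeplitz_form_nonneg_disc[OF sums Re_F])
  ultimately have "0 \<le> Q 1"
    by (intro tendsto_lowerbound) auto
  then show ?thesis by (simp add: Q_def sum_distrib_left mult_ac)
qed

text \<open>The range of \<open>s\<close> covers all orders in the scheme: \<open>\<gamma>\<close>,
  \<open>1 - \<beta>\<close> and \<open>-\<beta>\<close>.\<close>

lemma weight_form_nonneg:
  fixes x :: "nat \<Rightarrow> real"
  assumes "\<bar>s\<bar> \<le> 1"
  shows "0 \<le> (\<Sum>k\<le>n. (\<Sum>l\<le>k. weight s (k - l) * x l) * x k)"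
  unfolding weight_eq_bdf2_coeff
  by (rule toeplitz_form_nonneg[OF bdf2_symbol_sums])
    (use Re_bdf2_symbol_nonneg[OF _ assms] in \<open>simp_all add: zero_le_mult_iff\<close>)

subsection \<open>Inequalities for real sequences\<close>

text \<open>A Schur test: \<open>x l * x k\<close> is split by Young's inequality, and the row sums
  and column sums of the triangular matrix \<open>c (k - l)\<close> are both bounded by the sum of
  \<open>c\<close>.\<close>

lemma convolution_form_le:
  fixes c x :: "nat \<Rightarrow> real"
  assumes "\<And>k. c k \<ge> 0"
  shows "(\<Sum>k\<le>n. (\<Sum>l\<le>k. c (k - l) * x l) * x k) \<le> (\<Sum>j\<le>n. c j) * (\<Sum>k\<le>n. (x k)\<^sup>2)"
proof -
  have row: "(\<Sum>l\<le>k. c (k - l)) \<le> (\<Sum>j\<le>n. c j)" if "k \<le> n" for k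
  proof -
    have "(\<Sum>l\<le>k. c (k - l)) = (\<Sum>j\<le>k. c j)"
      by (rule sum.reindex_bij_witness[of _ "\<lambda>j. k - j" "\<lambda>j. k - j"]) auto
    also have "\<dots> \<le> (\<Sum>j\<le>n. c j)" using that assms by (intro sum_mono2) auto
    finally show ?thesis .
  qed
  have col: "(\<Sum>k\<in>{l..n}. c (k - l)) \<le> (\<Sum>j\<le>n. c j)" for l
  proof -
    have "(\<Sum>k\<in>{l..n}. c (k - l)) = (\<Sum>j\<in>(\<lambda>k. k - l) ` {l..n}. c j)"
      by (subst sum.reindex) (auto simp: inj_on_def)
    also have "\<dots> \<le> (\<Sum>j\<le>n. c j)" using assms by (intro sum_mono2) auto
    finally show ?thesis .
  qed
  have "c (k - l) * x l * x k \<le> c (k - l) * (x k)\<^sup>2 / 2 + c (k - l) * (x l)\<^sup>2 / 2" for k l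
  proof -
    have "x l * x k \<le> ((x k)\<^sup>2 + (x l)\<^sup>2) / 2" using sum_squares_bound[of "x l" "x k"] by simp
    from mult_left_mono[OF this assms[of "k - l"]] show ?thesis by (simp add: field_simps)
  qed
  then have "(\<Sum>k\<le>n. (\<Sum>l\<le>k. c (k - l) * x l) * x k)
      \<le> (\<Sum>k\<le>n. \<Sum>l\<le>k. c (k - l) * (x k)\<^sup>2 / 2 + c (k - l) * (x l)\<^sup>2 / 2)"
    unfolding sum_distrib_right by (intro sum_mono)
  also have "\<dots> = (\<Sum>k\<le>n. \<Sum>l\<le>k. c (k - l) * (x k)\<^sup>2) / 2 + (\<Sum>k\<le>n. \<Sum>l\<le>k. c (k - l) * (x l)\<^sup>2) / 2"
    by (simp add: sum.distrib sum_divide_distrib)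
  also have "(\<Sum>k\<le>n. \<Sum>l\<le>k. c (k - l) * (x l)\<^sup>2) = (\<Sum>l\<le>n. \<Sum>k\<in>{l..n}. c (k - l) * (x l)\<^sup>2)"
    by (subst sum.Sigma, simp, simp, subst sum.Sigma, simp, simp)
      (rule sum.reindex_bij_witness[of _ "\<lambda>(l,k). (k,l)" "\<lambda>(l,k). (k,l)"], auto)
  also have "\<dots> \<le> (\<Sum>l\<le>n. (\<Sum>j\<le>n. c j) * (x l)\<^sup>2)"
    using col by (intro sum_mono) (simp add: mult_right_mono flip: sum_distrib_right)
  also have "(\<Sum>k\<le>n. \<Sum>l\<le>k. c (k - l) * (x k)\<^sup>2) \<le> (\<Sum>l\<le>n. (\<Sum>j\<le>n. c j) * (x l)\<^sup>2)"
    using row by (intro sum_mono) (simp add: mult_right_mono flip: sum_distrib_right)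
  finally show ?thesis by (simp add: sum_distrib_left)
qed

text \<open>For a negative exponent the signs cancel and both binomial series have coefficients made
  of rising factorials of \<open>\<beta>\<close>; a Cauchy product of nonnegative sequences is
  nonnegative.\<close>

lemma weight_neg_nonneg:
  assumes "\<beta> \<ge> 0"
  shows "weight (-\<beta>) k \<ge> 0"
proof -
  have a: "(- \<beta> gchoose i) * (-1) ^ i = pochhammer \<beta> i / fact i" for i
    by (simp add: gbinomial_pochhammer flip: power_mult_distrib)
  have p: "pochhammer \<beta> i \<ge> 0" for i
    using assms by (auto simp: pochhammer_prod intro!: prod_nonneg)
  have b: "(- \<beta> gchoose i) * (-1/3) ^ i = pochhammer \<beta> i / fact i * (1/3) ^ i" for i
    unfolding a[symmetric] by (simp flip: power_mult_distrib)
  show ?thesis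
    unfolding weight_eq_bdf2_coeff bdf2_coeff_def a b
    using p by (auto intro!: mult_nonneg_nonneg sum_nonneg divide_nonneg_nonneg)
qed

lemma sum_weight_neg_le:
  assumes "0 < \<beta>" "\<beta> < 1" "K \<ge> (1::nat)"
  shows "(\<Sum>j\<le>K. weight (-\<beta>) j) \<le> 6 * real K powr \<beta>"
proof -
  \<comment> \<open>The generating function at \<open>r\<close> has size \<open>O(K powr \<beta>)\<close> while \<open>r ^ K\<close> stays above \<open>1/3\<close>.\<close>
  define r where "r = real K / (real K + 1)"
  have r: "0 < r" "r < 1" using assms by (auto simp: r_def field_simps)
  have sums: "(\<lambda>k. weight (-\<beta>) k * r ^ k) sums ((3/2 - 2 * r + 1/2 * r\<^sup>2) powr (-\<beta>))"
    unfolding weight_eq_bdf2_coeff using bdf2_symbol_sums_real[of r] r by simp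
  have "1 \<le> 3 * r ^ j" if "j \<le> K" for j
  proof -
    have "1 / r = 1 + 1 / real K" using assms by (simp add: r_def field_simps)
    also have "\<dots> \<le> exp (1 / real K)" by (rule exp_ge_add_one_self)
    finally have "(1 / r) ^ K \<le> exp (1 / real K) ^ K" using r by (intro power_mono) auto
    also have "\<dots> = exp 1" using assms by (simp flip: exp_of_nat_mult)
    also have "\<dots> \<le> 3" by (rule exp_le)
    finally have "1 \<le> 3 * r ^ K" using r by (simp add: field_simps)
    also have "\<dots> \<le> 3 * r ^ j" using r that by (simp add: power_decreasing)
    finally show ?thesis .
  qed
  then have "weight (-\<beta>) j * 1 \<le> weight (-\<beta>) j * (3 * r ^ j)" if "j \<le> K" for j
    by (intro mult_left_mono) (use that assms weight_neg_nonneg in auto)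
  then have "(\<Sum>j\<le>K. weight (-\<beta>) j) \<le> (\<Sum>j\<le>K. 3 * (weight (-\<beta>) j * r ^ j))"
    by (intro sum_mono) (simp add: mult_ac)
  also have "\<dots> \<le> 3 * (3/2 - 2 * r + 1/2 * r\<^sup>2) powr (-\<beta>)"
    unfolding sum_distrib_left[symmetric] sums_unique[OF sums]
    using assms r weight_neg_nonneg by (auto intro!: sum_le_suminf sums_summable[OF sums])
  \<comment> \<open>The symbol at \<open>r\<close> is at least \<open>1 - r = 1/(K + 1)\<close>, and
    the negative exponent reverses the inequality. The final constant 6 is the 3 from
    \<open>r ^ j\<close> times the 2 from \<open>K + 1 \<le> 2 * K\<close>.\<close>
  also have "(3/2 - 2 * r + 1/2 * r\<^sup>2) powr (-\<beta>) \<le> (1 / (real K + 1)) powr (-\<beta>)"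
  proof (rule powr_mono2')
    have "3/2 - 2 * r + 1/2 * r\<^sup>2 = (1 - r) + (1 - r)\<^sup>2 / 2"
      by (simp add: power2_eq_square field_simps)
    moreover have "1 - r = 1 / (real K + 1)" by (simp add: r_def field_simps)
    ultimately show "1 / (real K + 1) \<le> 3/2 - 2 * r + 1/2 * r\<^sup>2" by simp
  qed (use assms in auto)
  also have "\<dots> = (real K + 1) powr \<beta>"
    by (simp add: powr_divide powr_minus)
  also have "\<dots> \<le> (2 * real K) powr \<beta>"
    using assms by (intro powr_mono2) auto
  also have "\<dots> = 2 powr \<beta> * real K powr \<beta>" by (simp add: powr_mult)
  also have "\<dots> \<le> 2 * real K powr \<beta>"
    using powr_mono[of \<beta> 1 "2::real"] assms by (intro mult_right_mono) auto
  finally show ?thesis by simp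
qed

text \<open>G-stability of BDF2: the tested difference is the increment of the energy on the left
  plus a quarter of a squared second difference. For \<open>n = 1\<close> the Euler step gives
  equality, which fixes the subtracted term.\<close>

lemma dtau_telescope:
  assumes "\<tau> \<noteq> 0" "n \<ge> 1" "w 0 z = 0"
  shows "((w n z)\<^sup>2 + (2 * w n z - w (n - 1) z)\<^sup>2) / 4 - (w 1 z)\<^sup>2 / 4 \<le> (\<Sum>k=1..n. \<tau> * (dtau \<tau> w k z * w k z))"
  using assms(2)
proof (induction n rule: dec_induct)
  case base
  then show ?case using assms by (simp add: dtau_def power2_eq_square)
next
  case (step n)
  have "((w (Suc n) z)\<^sup>2 + (2 * w (Suc n) z - w n z)\<^sup>2) / 4 - ((w n z)\<^sup>2 + (2 * w n z - w (n - 1) z)\<^sup>2) / 4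
    + (w (Suc n) z - 2 * w n z + w (n - 1) z)\<^sup>2 / 4
    = (3 * w (Suc n) z - 4 * w n z + w (n - 1) z) / 2 * w (Suc n) z"
    by (simp add: power2_eq_square field_simps)
  also have "\<dots> = \<tau> * (dtau \<tau> w (Suc n) z * w (Suc n) z)"
    using assms step by (simp add: dtau_def numeral_2_eq_2)
  finally have increment: "((w (Suc n) z)\<^sup>2 + (2 * w (Suc n) z - w n z)\<^sup>2) / 4
      - ((w n z)\<^sup>2 + (2 * w n z - w (n - 1) z)\<^sup>2) / 4 + (w (Suc n) z - 2 * w n z + w (n - 1) z)\<^sup>2 / 4
      = \<tau> * (dtau \<tau> w (Suc n) z * w (Suc n) z)" .
  have split: "(\<Sum>k=1..Suc n. \<tau> * (dtau \<tau> w k z * w k z))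
      = (\<Sum>k=1..n. \<tau> * (dtau \<tau> w k z * w k z)) + \<tau> * (dtau \<tau> w (Suc n) z * w (Suc n) z)"
    by simp
  have "0 \<le> (w (Suc n) z - 2 * w n z + w (n - 1) z)\<^sup>2 / 4" by simp
  then show ?case
    using step.IH increment unfolding split diff_Suc_1 by linarith
qed

lemma dtau_energy_ge:
  assumes "\<tau> \<noteq> 0" "n \<ge> 1" "w 0 z = 0"
  shows "(w n z)\<^sup>2 / 4 - (w 1 z)\<^sup>2 / 4 \<le> (\<Sum>k=1..n. \<tau> * (dtau \<tau> w k z * w k z))"
  using dtau_telescope[of \<tau> n w z, OF assms] zero_le_power2[of "2 * w n z - w (n - 1) z"]
  unfolding add_divide_distrib by linarith

lemma discrete_gronwall:
  fixes E :: "nat \<Rightarrow> real"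
  assumes "A \<ge> 0" "B \<ge> 0" "n \<ge> 1"
    and "\<And>m. 1 \<le> m \<Longrightarrow> m \<le> n \<Longrightarrow> E m \<le> A + B * (\<Sum>k=1..<m. E k)"
  shows "E n \<le> A * exp (B * real n)"
proof -
  \<comment> \<open>The induction runs on the majorant rather than on \<open>E\<close>: passing from
    \<open>m\<close> to \<open>Suc m\<close> multiplies it by at most \<open>1 + B\<close>, hence by
    at most \<open>exp B\<close>.\<close>
  have "A + B * (\<Sum>k=1..<m. E k) \<le> A * exp (B * real m)" if "1 \<le> m" "m \<le> n" for m
    using that
  proof (induction m rule: dec_induct)
    case base
    then show ?case using assms by (simp add: mult_le_cancel_left1)
  next
    case (step m)
    let ?S = "A + B * (\<Sum>k=1..<m. E k)"
    have "A + B * (\<Sum>k=1..<Suc m. E k) = ?S + B * E m"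
      using step by (simp add: ring_distribs)
    also have "\<dots> \<le> ?S + B * ?S"
      using step assms by (intro add_left_mono mult_left_mono) auto
    also have "\<dots> = (1 + B) * ?S" by (simp add: ring_distribs)
    also have "\<dots> \<le> exp B * (A * exp (B * real m))"
    proof (rule order_trans[OF mult_left_mono mult_right_mono])
      show "?S \<le> A * exp (B * real m)" using step by simp
    qed (use assms exp_ge_add_one_self[of B] in auto)
    also have "\<dots> = A * exp (B * real (Suc m))" by (simp add: exp_add ring_distribs)
    finally show ?case .
  qed
  from this[of n] assms(4)[of n] assms(3) show ?thesis by simp
qed

text \<open>In the application \<open>E\<close> is the squared norm of the solution,
  \<open>F\<close> that of the data, and \<open>G\<close> the summed difference quotient tested with
  the solution.\<close>

lemma bdf2_energy_stability:
  fixes E F G :: "nat \<Rightarrow> real"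
  assumes \<tau>: "\<tau> > 0" "10 * M * \<tau> \<le> 1" "\<tau> * real n \<le> 1" and n: "n \<ge> 1" and M: "M \<ge> 0"
    and nonneg: "\<And>k. E k \<ge> 0" "\<And>k. F k \<ge> 0"
    and upper: "\<And>m. 1 \<le> m \<Longrightarrow> m \<le> n \<Longrightarrow> G m \<le> \<tau> * (M * (\<Sum>k=1..m. E k) + (\<Sum>k=1..m. F k) / 2)"
    and lower: "E 1 \<le> G 1" "\<And>m. 1 \<le> m \<Longrightarrow> m \<le> n \<Longrightarrow> E m / 4 - E 1 / 4 \<le> G m"
  shows "E n \<le> 5 * exp (10 * M) * \<tau> * (\<Sum>k=1..n. F k)"
proof -
  define R where "R m = \<tau> * (M * (\<Sum>k=1..m. E k) + (\<Sum>k=1..m. F k) / 2)" for m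
  define A where "A = 5 * \<tau> * (\<Sum>k=1..n. F k)"
  have "E n \<le> A * exp (10 * M * \<tau> * real n)"
  proof (rule discrete_gronwall)
    fix m assume m: "1 \<le> m" "m \<le> n"
    have "E 1 \<le> R 1" using upper[of 1] lower(1) n by (simp add: R_def)
    also have "\<dots> \<le> R m"
      unfolding R_def using m \<tau> M nonneg
      by (intro mult_left_mono add_mono divide_right_mono sum_mono2) auto
    \<comment> \<open>Four copies of \<open>R m\<close> come from the telescoped energy and one from
      the loss \<open>E 1\<close>.\<close>
    finally have "E m \<le> 5 * R m"
      using upper[OF m] lower(2)[OF m] unfolding R_def by linarith
    also have "(\<Sum>k=1..m. E k) = E m + (\<Sum>k=1..<m. E k)"
      using m by (simp add: sum.last_plus)
    then have "5 * R m = (5 * M * \<tau>) * E m + 5 * M * \<tau> * (\<Sum>k=1..<m. E k) + 5 / 2 * \<tau> * (\<Sum>k=1..m. F k)"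
      unfolding R_def by (simp add: algebra_simps)
    \<comment> \<open>Here the small time step enters: the implicit term at level \<open>m\<close>
      is absorbed into the left-hand side, which doubles the remaining constants.\<close>
    also have "(5 * M * \<tau>) * E m \<le> 1 / 2 * E m"
      using \<tau> nonneg by (intro mult_right_mono) auto
    finally have "E m \<le> 10 * M * \<tau> * (\<Sum>k=1..<m. E k) + 5 * \<tau> * (\<Sum>k=1..m. F k)"
      by (simp add: mult.assoc)
    moreover have "5 * \<tau> * (\<Sum>k=1..m. F k) \<le> A"
      unfolding A_def using m \<tau> nonneg by (intro mult_left_mono sum_mono2) auto
    ultimately show "E m \<le> A + 10 * M * \<tau> * (\<Sum>k=1..<m. E k)" by simp
  qed (use \<tau> M n nonneg in \<open>auto simp: A_def intro!: sum_nonneg mult_nonneg_nonneg\<close>)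
  also have "\<dots> \<le> A * exp (10 * M)"
  proof -
    have "10 * M * (\<tau> * real n) \<le> 10 * M * 1"
      using M \<tau> by (intro mult_left_mono) auto
    then show ?thesis
      using \<tau> nonneg by (intro mult_left_mono) (auto simp: A_def mult.assoc intro!: sum_nonneg mult_nonneg_nonneg)
  qed
  finally show ?thesis by (simp add: A_def mult_ac)
qed

subsection \<open>Energy estimate\<close>

lemma continuous_imp_L2:
  assumes "continuous_on {0..L} w"
  shows "w \<in> L2 L"
  unfolding L2_def
  using assms by (auto intro!: continuous_imp_measurable_on_sets_lebesgue continuous_imp_integrable_real continuous_intros)

lemma ip_self_nonneg: "0 \<le> ip L w w"
  unfolding ip_def by (rule Bochner_Integration.integral_nonneg) simp

lemma nrm_power2: "(nrm L w)\<^sup>2 = ip L w w"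
  by (simp add: nrm_def ip_self_nonneg)

lemma ip_commute: "ip L v w = ip L w v"
  by (simp add: ip_def mult.commute)

text \<open>Young's inequality, integrated. The sources are only square integrable, so the same
  pointwise bound also supplies the integrability of the product.\<close>

lemma ip_le_half_squares:
  assumes v: "v \<in> L2 L" and w: "w \<in> L2 L"
  shows "ip L v w \<le> ((nrm L v)\<^sup>2 + (nrm L w)\<^sup>2) / 2"
proof -
  let ?M = "lebesgue_on {0..L}"
  have bound: "\<bar>v z * w z\<bar> \<le> ((v z)\<^sup>2 + (w z)\<^sup>2) / 2" for z
    using sum_squares_bound[of "\<bar>v z\<bar>" "\<bar>w z\<bar>"] by (simp add: abs_mult)
  have sq: "integrable ?M (\<lambda>z. (v z)\<^sup>2)" "integrable ?M (\<lambda>z. (w z)\<^sup>2)"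
    and meas: "v \<in> borel_measurable ?M" "w \<in> borel_measurable ?M"
    using v w by (auto simp: L2_def)
  have int: "integrable ?M (\<lambda>z. ((v z)\<^sup>2 + (w z)\<^sup>2) / 2)" using sq by simp
  have "integrable ?M (\<lambda>z. v z * w z)"
    by (rule Bochner_Integration.integrable_bound[OF int]) (use meas bound in auto)
  then have "ip L v w \<le> (LINT z|?M. ((v z)\<^sup>2 + (w z)\<^sup>2) / 2)"
    unfolding ip_def by (rule integral_mono[OF _ int]) (use bound abs_le_D1 in blast)
  also have "\<dots> = ((nrm L v)\<^sup>2 + (nrm L w)\<^sup>2) / 2"
    unfolding nrm_power2 ip_def using sq by (simp add: power2_eq_square)
  finally show ?thesis .
qed

text \<open>Moves the sum over time levels under the integral, so that the inequalities for real
  sequences apply at each point \<open>z\<close>.\<close>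

lemma sum_ip_eq:
  assumes "\<And>k. k \<in> I \<Longrightarrow> continuous_on {0..L} (v k)" "\<And>k. k \<in> I \<Longrightarrow> continuous_on {0..L} (w k)"
  shows "(\<Sum>k\<in>I. ip L (v k) (w k)) = (LINT z|lebesgue_on {0..L}. (\<Sum>k\<in>I. v k z * w k z))"
    and "integrable (lebesgue_on {0..L}) (\<lambda>z. \<Sum>k\<in>I. v k z * w k z)"
proof -
  have int: "integrable (lebesgue_on {0..L}) (\<lambda>z. v k z * w k z)" if "k \<in> I" for k
    using assms[OF that] by (intro continuous_imp_integrable_real continuous_intros)
  show "(\<Sum>k\<in>I. ip L (v k) (w k)) = (LINT z|lebesgue_on {0..L}. (\<Sum>k\<in>I. v k z * w k z))"
    unfolding ip_def using int by (simp add: Bochner_Integration.integral_sum)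
  show "integrable (lebesgue_on {0..L}) (\<lambda>z. \<Sum>k\<in>I. v k z * w k z)"
    using int by (rule Bochner_Integration.integrable_sum)
qed

lemma sum_ip_mono:
  assumes "\<And>k. k \<in> I \<Longrightarrow> continuous_on {0..L} (v k)" "\<And>k. k \<in> I \<Longrightarrow> continuous_on {0..L} (w k)"
    "\<And>k. k \<in> J \<Longrightarrow> continuous_on {0..L} (x k)" "\<And>k. k \<in> J \<Longrightarrow> continuous_on {0..L} (y k)"
    and "\<And>z. c * (\<Sum>k\<in>I. v k z * w k z) \<le> d * (\<Sum>k\<in>J. x k z * y k z)"
  shows "c * (\<Sum>k\<in>I. ip L (v k) (w k)) \<le> d * (\<Sum>k\<in>J. ip L (x k) (y k))"
proof -
  have "(LINT z|lebesgue_on {0..L}. c * (\<Sum>k\<in>I. v k z * w k z))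
      \<le> (LINT z|lebesgue_on {0..L}. d * (\<Sum>k\<in>J. x k z * y k z))"
    by (rule integral_mono) (use sum_ip_eq(2)[of I L v w] sum_ip_eq(2)[of J L x y] assms in auto)
  then show ?thesis
    using sum_ip_eq(1)[of I L v w] sum_ip_eq(1)[of J L x y] assms by simp
qed

section \<open>Summed inner products of the discrete time operators\<close>

lemma continuous_on_Dfrac:
  assumes "\<And>l. l \<le> k \<Longrightarrow> continuous_on {0..L} (w l)"
  shows "continuous_on {0..L} (Dfrac \<tau> s w k)"
proof -
  have "continuous_on {0..L} (\<lambda>z. \<tau> powr (- s) * (\<Sum>l=0..k. weight s (k - l) * w l z))"
    using assms by (intro continuous_intros) auto
  then show ?thesis unfolding Dfrac_def[abs_def] .
qed

lemma continuous_on_dtau: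
  assumes "\<And>l. l \<le> k \<Longrightarrow> continuous_on {0..L} (w l)" "k \<ge> 1" "\<tau> > 0"
  shows "continuous_on {0..L} (dtau \<tau> w k)"
proof -
  have "continuous_on {0..L} (\<lambda>z. (w 1 z - w 0 z) / \<tau>)"
    "continuous_on {0..L} (\<lambda>z. (3 * w k z - 4 * w (k - 1) z + w (k - 2) z) / (2 * \<tau>))"
    using assms by (intro continuous_intros; simp)+
  then show ?thesis unfolding dtau_def[abs_def] by (cases "k = 1") simp_all
qed

text \<open>The zero initial value lets the sum start at level 0, the form in which the quadratic
  forms of the weights are estimated.\<close>

lemma sum_Dfrac_eq:
  assumes "w 0 z = 0"
  shows "(\<Sum>k=1..n. Dfrac \<tau> s w k z * w k z)
    = \<tau> powr (- s) * (\<Sum>k\<le>n. (\<Sum>l\<le>k. weight s (k - l) * w l z) * w k z)"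
proof -
  have "(\<Sum>k=1..n. Dfrac \<tau> s w k z * w k z) = (\<Sum>k\<le>n. Dfrac \<tau> s w k z * w k z)"
    by (rule sum.mono_neutral_left) (use assms in \<open>auto simp: not_le\<close>)
  then show ?thesis
    by (simp add: Dfrac_def mult.assoc atMost_atLeast0 flip: sum_distrib_left)
qed

lemma sum_ip_Dfrac_nonneg:
  assumes "\<bar>s\<bar> \<le> 1" "\<And>k. k \<le> n \<Longrightarrow> continuous_on {0..L} (w k)" "\<And>z. w 0 z = 0"
  shows "0 \<le> (\<Sum>k=1..n. ip L (Dfrac \<tau> s w k) (w k))"
proof -
  have "0 \<le> (\<Sum>k=1..n. Dfrac \<tau> s w k z * w k z)" for z
    unfolding sum_Dfrac_eq[of w, OF assms(3)] using weight_form_nonneg[OF assms(1)] by (intro mult_nonneg_nonneg) auto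
  moreover have "(\<Sum>k=1..n. ip L (Dfrac \<tau> s w k) (w k))
      = (LINT z|lebesgue_on {0..L}. (\<Sum>k=1..n. Dfrac \<tau> s w k z * w k z))"
    by (rule sum_ip_eq) (use assms(2) in \<open>auto intro!: continuous_on_Dfrac\<close>)
  ultimately show ?thesis by simp
qed

text \<open>The factor \<open>\<tau> powr \<beta>\<close> in \<open>Dfrac\<close> balances the
  growth \<open>n powr \<beta>\<close> of the summed weights because
  \<open>\<tau> * n \<le> 1\<close>; the constant is therefore free of \<open>\<tau>\<close> and
  \<open>n\<close>.\<close>

lemma sum_ip_Dfrac_neg_le:
  assumes "0 < \<beta>" "\<beta> < 1" "\<tau> > 0" "\<tau> * real n \<le> 1" "n \<ge> 1"
    and "\<And>k. k \<le> n \<Longrightarrow> continuous_on {0..L} (w k)" "\<And>z. w 0 z = 0"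
  shows "(\<Sum>k=1..n. ip L (Dfrac \<tau> (-\<beta>) w k) (w k)) \<le> 6 * (\<Sum>k=1..n. (nrm L (w k))\<^sup>2)"
proof -
  have "\<tau> powr \<beta> * (\<Sum>j\<le>n. weight (-\<beta>) j) \<le> \<tau> powr \<beta> * (6 * real n powr \<beta>)"
    using sum_weight_neg_le[of \<beta> n] assms by (intro mult_left_mono) auto
  also have "\<dots> = 6 * (\<tau> * real n) powr \<beta>" using assms by (simp add: powr_mult)
  also have "\<dots> \<le> 6" using powr_mono2[of \<beta> "\<tau> * real n" 1] assms by simp
  finally have c: "\<tau> powr \<beta> * (\<Sum>j\<le>n. weight (-\<beta>) j) \<le> 6" .
  have "1 * (\<Sum>k=1..n. Dfrac \<tau> (-\<beta>) w k z * w k z) \<le> 6 * (\<Sum>k=1..n. w k z * w k z)" for z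
  proof -
    have "1 * (\<Sum>k=1..n. Dfrac \<tau> (-\<beta>) w k z * w k z)
      \<le> \<tau> powr \<beta> * ((\<Sum>j\<le>n. weight (-\<beta>) j) * (\<Sum>k\<le>n. (w k z)\<^sup>2))"
      unfolding sum_Dfrac_eq[of w, OF assms(7)]
      using convolution_form_le[where c = "weight (-\<beta>)" and n = n and x = "\<lambda>k. w k z"] weight_neg_nonneg assms
      by (simp add: mult_left_mono)
    also have "\<dots> \<le> 6 * (\<Sum>k\<le>n. (w k z)\<^sup>2)"
      unfolding mult.assoc[symmetric] by (intro mult_right_mono c sum_nonneg) auto
    also have "(\<Sum>k\<le>n. (w k z)\<^sup>2) = (\<Sum>k=1..n. (w k z)\<^sup>2)"
      by (rule sum.mono_neutral_right) (use assms in \<open>auto simp: not_le\<close>)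
    finally show ?thesis by (simp add: power2_eq_square)
  qed
  then have "1 * (\<Sum>k=1..n. ip L (Dfrac \<tau> (-\<beta>) w k) (w k)) \<le> 6 * (\<Sum>k=1..n. ip L (w k) (w k))"
    by (intro sum_ip_mono) (use assms(6) in \<open>auto intro!: continuous_on_Dfrac\<close>)
  then show ?thesis by (simp add: nrm_power2)
qed

lemma sum_ip_dtau_ge:
  assumes "\<tau> > 0" "n \<ge> 1"
    and "\<And>k. k \<le> n \<Longrightarrow> continuous_on {0..L} (w k)" "\<And>z. w 0 z = 0"
  shows "(nrm L (w n))\<^sup>2 / 4 - (nrm L (w 1))\<^sup>2 / 4 \<le> \<tau> * (\<Sum>k=1..n. ip L (dtau \<tau> w k) (w k))"
proof -
  define I where "I = {1..n}"
  have "continuous_on {0..L} (dtau \<tau> w k)" if "k \<in> I" for k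
    using that assms by (intro continuous_on_dtau) (auto simp: I_def)
  note eqs = sum_ip_eq[of I L "dtau \<tau> w" w, OF this] 
  have cont: "k \<in> I \<Longrightarrow> continuous_on {0..L} (w k)" for k
    using assms by (auto simp: I_def)
  have int: "integrable (lebesgue_on {0..L}) (\<lambda>z. w k z * w k z)" if "k \<in> I" for k
    using cont[OF that] by (intro continuous_imp_integrable_real continuous_intros)
  have "1 \<in> I" "n \<in> I" using assms by (auto simp: I_def)
  have "(nrm L (w n))\<^sup>2 / 4 - (nrm L (w 1))\<^sup>2 / 4
      = (LINT z|lebesgue_on {0..L}. w n z * w n z / 4 - w 1 z * w 1 z / 4)"
    unfolding nrm_power2 ip_def using int[OF \<open>1 \<in> I\<close>] int[OF \<open>n \<in> I\<close>] by simp
  also have "\<dots> \<le> (LINT z|lebesgue_on {0..L}. \<tau> * (\<Sum>k\<in>I. dtau \<tau> w k z * w k z))"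
  proof (rule integral_mono)
    show "w n z * w n z / 4 - w 1 z * w 1 z / 4 \<le> \<tau> * (\<Sum>k\<in>I. dtau \<tau> w k z * w k z)" for z
      using dtau_energy_ge[of \<tau> n w z] assms
      by (simp add: I_def power2_eq_square sum_distrib_left)
  qed (use int[OF \<open>1 \<in> I\<close>] int[OF \<open>n \<in> I\<close>] eqs(2) cont in auto)
  also have "\<dots> = \<tau> * (\<Sum>k\<in>I. ip L (dtau \<tau> w k) (w k))"
    using eqs(1) cont by simp
  finally show ?thesis by (simp add: I_def)
qed

text \<open>The first step is implicit Euler from zero data; this identity controls the loss at
  level 1 in the telescoped energy.\<close>

lemma ip_dtau_first:
  assumes "\<tau> > 0" "\<And>z. w 0 z = 0"
  shows "\<tau> * ip L (dtau \<tau> w 1) (w 1) = (nrm L (w 1))\<^sup>2"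
  using assms unfolding nrm_power2 ip_def by (simp add: dtau_def)

section \<open>Regularity and energy balance of the scheme\<close>

lemma V0_smooth:
  assumes "w \<in> V0 L N"
  shows "continuous_on {0..L} w" "continuous_on {0..L} (deriv w)"
proof -
  from assms obtain q where w: "w = poly q" by (auto simp: V0_def P_space_def)
  have "deriv w = poly (pderiv q)" unfolding w by (auto intro!: DERIV_imp_deriv poly_DERIV)
  then show "continuous_on {0..L} w" "continuous_on {0..L} (deriv w)"
    unfolding w by (simp_all add: continuous_on_poly continuous_on_id)
qed

lemma spectral_scheme_continuous:
  assumes scheme: "spectral_scheme a1 a2 a3 a4 a5 b1 b2 b3 b4 \<gamma> \<beta> L \<tau> K N f g p u v \<theta>" and "k \<le> K"
  shows "continuous_on {0..L} (u k)" "continuous_on {0..L} (v k)" "continuous_on {0..L} (\<theta> k)"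
    "continuous_on {0..L} (grad u k)" "continuous_on {0..L} (grad v k)" "continuous_on {0..L} (grad \<theta> k)"
proof -
  have "continuous_on {0..L} w \<and> continuous_on {0..L} (deriv w)" if "w \<in> {u k, v k, \<theta> k}" for w
  proof (cases "k = 0")
    case True
    then have "w = (\<lambda>z. 0)" using scheme that by (auto simp: spectral_scheme_def)
    then show ?thesis by simp
  next
    case False
    then have "w \<in> V0 L N" using scheme that \<open>k \<le> K\<close> by (auto simp: spectral_scheme_def)
    then show ?thesis using V0_smooth by blast
  qed
  then show "continuous_on {0..L} (u k)" "continuous_on {0..L} (v k)" "continuous_on {0..L} (\<theta> k)"
    "continuous_on {0..L} (grad u k)" "continuous_on {0..L} (grad v k)" "continuous_on {0..L} (grad \<theta> k)"
    by blast+
qed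

text \<open>In the constant, \<open>1/2\<close> comes from Young's inequality for the sources,
  \<open>a5/2\<close> from the coupling of \<open>\<theta>\<close> into the first equation,
  \<open>b4\<close> from the zero-order term and \<open>6*b3\<close> from the bound on the
  fractional sum of order \<open>-\<beta>\<close>.\<close>

lemma spectral_scheme_energy:
  assumes pos: "a1 > 0" "a2 > 0" "a3 > 0" "a4 > 0" "a5 > 0" "b1 > 0" "b2 > 0" "b3 > 0" "b4 > 0"
    and exps: "0 < \<gamma>" "\<gamma> < 1" "0 < \<beta>" "\<beta> < 1"
    and \<tau>: "\<tau> > 0" "\<tau> * real m \<le> 1" and m: "1 \<le> m" "m \<le> K"
    and L2: "\<And>k. k \<le> K \<Longrightarrow> at_level \<tau> f k \<in> L2 L \<and> at_level \<tau> g k \<in> L2 L \<and> at_level \<tau> p k \<in> L2 L"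
    and scheme: "spectral_scheme a1 a2 a3 a4 a5 b1 b2 b3 b4 \<gamma> \<beta> L \<tau> K N f g p u v \<theta>"
  shows "(\<Sum>k=1..m. ip L (dtau \<tau> u k) (u k) + ip L (dtau \<tau> v k) (v k) + ip L (dtau \<tau> \<theta> k) (\<theta> k))
    \<le> (1/2 + a5/2 + b4 + 6*b3) * (\<Sum>k=1..m. (nrm L (u k))\<^sup>2 + (nrm L (v k))\<^sup>2 + (nrm L (\<theta> k))\<^sup>2)
      + (\<Sum>k=1..m. (nrm L (at_level \<tau> f k))\<^sup>2 + (nrm L (at_level \<tau> g k))\<^sup>2 + (nrm L (at_level \<tau> p k))\<^sup>2) / 2"
proof -
  have init: "u 0 = (\<lambda>z. 0)" "v 0 = (\<lambda>z. 0)" "\<theta> 0 = (\<lambda>z. 0)"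
    using scheme by (auto simp: spectral_scheme_def)
  have V: "u k \<in> V0 L N" "v k \<in> V0 L N" "\<theta> k \<in> V0 L N" if "k \<in> {1..m}" for k
    using scheme that m by (auto simp: spectral_scheme_def)
  note cont = spectral_scheme_continuous[OF scheme order_trans[OF _ m(2)]]
  have grad0: "grad u 0 z = 0" "grad v 0 z = 0" "grad \<theta> 0 z = 0" for z
    by (simp_all add: init)
  define \<Delta> where "\<Delta> k = ip L (dtau \<tau> u k) (u k) + ip L (dtau \<tau> v k) (v k) + ip L (dtau \<tau> \<theta> k) (\<theta> k)" for k
  define F where "F k = (nrm L (at_level \<tau> f k))\<^sup>2 + (nrm L (at_level \<tau> g k))\<^sup>2 + (nrm L (at_level \<tau> p k))\<^sup>2" for k
  define E where "E k = (nrm L (u k))\<^sup>2 + (nrm L (v k))\<^sup>2 + (nrm L (\<theta> k))\<^sup>2" for k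
  \<comment> \<open>The fractional terms with a good sign. Their sign is known only after summation
    over \<open>k\<close>, so they are carried through the estimate at a single level.\<close>
  define D where "D k = a1 * ip L (Dfrac \<tau> \<gamma> u k) (u k) + a2 * ip L (Dfrac \<tau> \<gamma> (grad u) k) (grad u k)
      + a1 * ip L (Dfrac \<tau> \<gamma> v k) (v k) + a2 * ip L (Dfrac \<tau> \<gamma> (grad v) k) (grad v k)
      + b1 * ip L (Dfrac \<tau> (1 - \<beta>) \<theta> k) (\<theta> k) + b2 * ip L (Dfrac \<tau> (- \<beta>) (grad \<theta>) k) (grad \<theta> k)" for k
  define H where "H k = ip L (Dfrac \<tau> (- \<beta>) \<theta> k) (\<theta> k)" for k
  have step: "\<Delta> k \<le> (1/2 + a5/2 + b4) * E k + F k / 2 + b3 * H k - D k" if k: "k \<in> {1..m}" for k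
  proof -
    have L2k: "u k \<in> L2 L" "v k \<in> L2 L" "\<theta> k \<in> L2 L"
      using cont k by (auto intro!: continuous_imp_L2)
    have src: "at_level \<tau> f k \<in> L2 L" "at_level \<tau> g k \<in> L2 L" "at_level \<tau> p k \<in> L2 L"
      using L2[of k] k m by auto
    have eq_u: "ip L (dtau \<tau> u k) (u k) + a1 * ip L (Dfrac \<tau> \<gamma> u k) (u k)
            + a2 * ip L (Dfrac \<tau> \<gamma> (grad u) k) (deriv (u k))
            + ip L (deriv (u k)) (deriv (u k)) + a3 * ip L (u k) (u k)
            - a4 * ip L (v k) (u k) - a5 * ip L (\<theta> k) (u k)
          = ip L (at_level \<tau> f k) (u k)"
      and eq_v: "ip L (dtau \<tau> v k) (v k) + a1 * ip L (Dfrac \<tau> \<gamma> v k) (v k)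
            + a2 * ip L (Dfrac \<tau> \<gamma> (grad v) k) (deriv (v k))
            + ip L (deriv (v k)) (deriv (v k)) + a3 * ip L (v k) (v k)
            + a4 * ip L (u k) (v k)
          = ip L (at_level \<tau> g k) (v k)"
      and eq_\<theta>: "ip L (dtau \<tau> \<theta> k) (\<theta> k) + b1 * ip L (Dfrac \<tau> (1 - \<beta>) \<theta> k) (\<theta> k)
            + b2 * ip L (Dfrac \<tau> (- \<beta>) (grad \<theta>) k) (deriv (\<theta> k))
            - b3 * ip L (Dfrac \<tau> (- \<beta>) \<theta> k) (\<theta> k) - b4 * ip L (\<theta> k) (\<theta> k)
          = ip L (at_level \<tau> p k) (\<theta> k)"
      using scheme V[OF k] k m unfolding spectral_scheme_def by auto
    have dropped: "0 \<le> ip L (deriv (u k)) (deriv (u k))" "0 \<le> ip L (deriv (v k)) (deriv (v k))"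
      "0 \<le> a3 * ip L (u k) (u k)" "0 \<le> a3 * ip L (v k) (v k)"
      using pos by (simp_all add: ip_self_nonneg)
    have coupling: "a5 * ip L (\<theta> k) (u k) \<le> a5 * (((nrm L (\<theta> k))\<^sup>2 + (nrm L (u k))\<^sup>2) / 2)"
      using pos L2k by (intro mult_left_mono ip_le_half_squares) auto
    have "a5 * (((nrm L (\<theta> k))\<^sup>2 + (nrm L (u k))\<^sup>2) / 2) \<le> a5 * (E k / 2)"
      using pos by (intro mult_left_mono) (auto simp: E_def)
    moreover have "b4 * ip L (\<theta> k) (\<theta> k) \<le> b4 * E k"
      using pos by (intro mult_left_mono) (auto simp: E_def simp flip: nrm_power2)
    moreover have "ip L (at_level \<tau> f k) (u k) + ip L (at_level \<tau> g k) (v k) + ip L (at_level \<tau> p k) (\<theta> k)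
        \<le> F k / 2 + E k / 2"
      using ip_le_half_squares[OF src(1) L2k(1)] ip_le_half_squares[OF src(2) L2k(2)]
        ip_le_half_squares[OF src(3) L2k(3)]
      unfolding F_def E_def by (simp add: field_simps)
    moreover have "(1/2 + a5/2 + b4) * E k = E k / 2 + a5 * (E k / 2) + b4 * E k"
      by (simp add: algebra_simps)
    \<comment> \<open>Adding the three tested equations cancels the \<open>a4\<close> terms once the
      symmetry of \<open>ip\<close> has identified the two mixed products of \<open>u\<close> and
      \<open>v\<close>.\<close>
    ultimately show ?thesis
      using eq_u eq_v eq_\<theta> dropped coupling
      unfolding \<Delta>_def D_def H_def ip_commute[of L "v k" "u k"] by linarith
  qed
  have D: "0 \<le> (\<Sum>k=1..m. D k)"
    unfolding D_def sum.distrib sum_distrib_left[symmetric]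
    using pos exps cont grad0 init
    by (intro add_nonneg_nonneg mult_nonneg_nonneg sum_ip_Dfrac_nonneg) auto
  have "(\<Sum>k=1..m. H k) \<le> 6 * (\<Sum>k=1..m. (nrm L (\<theta> k))\<^sup>2)"
    unfolding H_def by (rule sum_ip_Dfrac_neg_le) (use exps \<tau> m cont init in auto)
  also have "\<dots> \<le> 6 * (\<Sum>k=1..m. E k)"
    by (intro mult_left_mono sum_mono) (auto simp: E_def)
  finally have H: "b3 * (\<Sum>k=1..m. H k) \<le> b3 * (6 * (\<Sum>k=1..m. E k))"
    using pos by (intro mult_left_mono) auto
  have "(\<Sum>k=1..m. \<Delta> k) \<le> (\<Sum>k=1..m. (1/2 + a5/2 + b4) * E k + F k / 2 + b3 * H k - D k)"
    by (rule sum_mono) (rule step)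
  also have "\<dots> = (1/2 + a5/2 + b4) * (\<Sum>k=1..m. E k) + (\<Sum>k=1..m. F k) / 2
      + b3 * (\<Sum>k=1..m. H k) - (\<Sum>k=1..m. D k)"
    by (simp add: sum.distrib sum_subtractf sum_distrib_left sum_divide_distrib)
  also have "\<dots> \<le> (1/2 + a5/2 + b4 + 6*b3) * (\<Sum>k=1..m. E k) + (\<Sum>k=1..m. F k) / 2"
    using D H by (simp add: algebra_simps)
  finally show ?thesis unfolding \<Delta>_def E_def F_def .
qed

theorem theorem1:
  fixes a1 a2 a3 a4 a5 b1 b2 b3 b4 \<gamma> \<beta> L T :: real
  assumes "a1 > 0" "a2 > 0" "a3 > 0" "a4 > 0" "a5 > 0"
    and "b1 > 0" "b2 > 0" "b3 > 0" "b4 > 0"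
    and "0 < \<gamma>" "\<gamma> < 1" "0 < \<beta>" "\<beta> < 1"
    and "L > 0" "0 < T" "T \<le> 1"
  shows "\<exists>C>0. \<exists>\<tau>\<^sub>0>0. \<forall>(K::nat) (N::nat) (\<tau>::real)
           (f :: real \<Rightarrow> real \<Rightarrow> real) (g :: real \<Rightarrow> real \<Rightarrow> real) (p :: real \<Rightarrow> real \<Rightarrow> real)
           (u :: nat \<Rightarrow> real \<Rightarrow> real) (v :: nat \<Rightarrow> real \<Rightarrow> real) (\<theta> :: nat \<Rightarrow> real \<Rightarrow> real).
         K \<ge> 1 \<longrightarrow> \<tau> = T / real K \<longrightarrow> \<tau> \<le> \<tau>\<^sub>0 \<longrightarrow>
         (\<forall>t\<in>{0..T}. (\<lambda>z. f z t) \<in> L2 L \<and> (\<lambda>z. g z t) \<in> L2 L \<and> (\<lambda>z. p z t) \<in> L2 L) \<longrightarrow>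
         spectral_scheme a1 a2 a3 a4 a5 b1 b2 b3 b4 \<gamma> \<beta> L \<tau> K N f g p u v \<theta> \<longrightarrow>
         (\<forall>n\<in>{1..K}.
            (nrm L (u n))\<^sup>2 + (nrm L (v n))\<^sup>2 + (nrm L (\<theta> n))\<^sup>2
            \<le> C * \<tau> * ((\<Sum>k=1..n. (nrm L (at_level \<tau> f k))\<^sup>2)
                      + (\<Sum>k=1..n. (nrm L (at_level \<tau> g k))\<^sup>2)
                      + (\<Sum>k=1..n. (nrm L (at_level \<tau> p k))\<^sup>2)))"
proof -
  \<comment> \<open>\<open>M\<close> depends only on \<open>a5\<close>, \<open>b3\<close> and
    \<open>b4\<close>, hence so do the witnesses \<open>C = 5 * exp (10 * M)\<close> and
    \<open>1 / (10 * M)\<close> for the step bound.\<close>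
  define M where "M = 1/2 + a5/2 + b4 + 6*b3"
  have M: "M > 0" using assms by (simp add: M_def add_pos_pos)
  have stable: "(nrm L (u n))\<^sup>2 + (nrm L (v n))\<^sup>2 + (nrm L (\<theta> n))\<^sup>2
            \<le> 5 * exp (10 * M) * \<tau> * ((\<Sum>k=1..n. (nrm L (at_level \<tau> f k))\<^sup>2)
                      + (\<Sum>k=1..n. (nrm L (at_level \<tau> g k))\<^sup>2)
                      + (\<Sum>k=1..n. (nrm L (at_level \<tau> p k))\<^sup>2))"
    if K: "K \<ge> 1" and \<tau>: "\<tau> = T / real K" "\<tau> \<le> 1 / (10 * M)"
      and L2: "\<forall>t\<in>{0..T}. (\<lambda>z. f z t) \<in> L2 L \<and> (\<lambda>z. g z t) \<in> L2 L \<and> (\<lambda>z. p z t) \<in> L2 L"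
      and scheme: "spectral_scheme a1 a2 a3 a4 a5 b1 b2 b3 b4 \<gamma> \<beta> L \<tau> K N f g p u v \<theta>"
      and n: "n \<in> {1..K}"
    for K N n :: nat and \<tau> :: real and f g p :: "real \<Rightarrow> real \<Rightarrow> real" and u v \<theta> :: "nat \<Rightarrow> real \<Rightarrow> real"
  proof -
    define E where "E k = (nrm L (u k))\<^sup>2 + (nrm L (v k))\<^sup>2 + (nrm L (\<theta> k))\<^sup>2" for k
    define F where "F k = (nrm L (at_level \<tau> f k))\<^sup>2 + (nrm L (at_level \<tau> g k))\<^sup>2 + (nrm L (at_level \<tau> p k))\<^sup>2" for k
    define G where "G m = \<tau> * (\<Sum>k=1..m. ip L (dtau \<tau> u k) (u k) + ip L (dtau \<tau> v k) (v k) + ip L (dtau \<tau> \<theta> k) (\<theta> k))" for m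
    have \<tau>_pos: "\<tau> > 0" and K\<tau>: "\<tau> * real K = T" using \<tau> K assms by auto
    have m\<tau>: "\<tau> * real m \<le> T" if "m \<le> K" for m
      unfolding K\<tau>[symmetric] using that \<tau>_pos by (intro mult_left_mono) auto
    have src: "at_level \<tau> f k \<in> L2 L \<and> at_level \<tau> g k \<in> L2 L \<and> at_level \<tau> p k \<in> L2 L" if "k \<le> K" for k
      using L2 m\<tau>[OF that] \<tau>_pos unfolding at_level_def[abs_def] by (simp add: mult.commute)
    have init: "u 0 = (\<lambda>z. 0)" "v 0 = (\<lambda>z. 0)" "\<theta> 0 = (\<lambda>z. 0)"
      using scheme by (auto simp: spectral_scheme_def)
    note cont = spectral_scheme_continuous[OF scheme]
    have "E n \<le> 5 * exp (10 * M) * \<tau> * (\<Sum>k=1..n. F k)"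
    proof (rule bdf2_energy_stability[where G = G])
      show "10 * M * \<tau> \<le> 1" using \<tau>(2) M by (simp add: field_simps)
      \<comment> \<open>The assumption \<open>T \<le> 1\<close> enters through the time
        horizon.\<close>
      show "\<tau> * real n \<le> 1" using m\<tau>[of n] n assms by auto
      show "G m \<le> \<tau> * (M * (\<Sum>k=1..m. E k) + (\<Sum>k=1..m. F k) / 2)" if m: "1 \<le> m" "m \<le> n" for m
        unfolding G_def E_def F_def M_def
        by (intro mult_left_mono spectral_scheme_energy[OF assms(1-13) \<tau>_pos _ m(1) _ src scheme])
          (use m n m\<tau>[of m] assms \<tau>_pos in auto)
      show "E 1 \<le> G 1"
        unfolding G_def E_def
        using ip_dtau_first[OF \<tau>_pos, of u L] ip_dtau_first[OF \<tau>_pos, of v L]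
          ip_dtau_first[OF \<tau>_pos, of \<theta> L] init by (simp add: ring_distribs)
      show "E m / 4 - E 1 / 4 \<le> G m" if m: "1 \<le> m" "m \<le> n" for m
      proof -
        have "(nrm L (w m))\<^sup>2 / 4 - (nrm L (w 1))\<^sup>2 / 4 \<le> \<tau> * (\<Sum>k=1..m. ip L (dtau \<tau> w k) (w k))"
          if "w \<in> {u, v, \<theta>}" for w
          by (rule sum_ip_dtau_ge) (use that m n cont init \<tau>_pos in auto)
        from this[of u] this[of v] this[of \<theta>] show ?thesis
          unfolding E_def G_def sum.distrib distrib_left add_divide_distrib by simp
      qed
    qed (use \<tau>_pos M n in \<open>auto simp: E_def F_def\<close>)
    then show ?thesis by (simp add: E_def F_def sum.distrib)
  qed
  show ?thesis
    by (rule exI[of _ "5 * exp (10 * M)"], intro conjI exI[of _ "1 / (10 * M)"] allI impI ballI stable)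
      (use M in auto)
qed

end
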